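(* Let $\mathcal{H}$ be a complex Hilbert space and let $D\subseteq\mathcal{H}$ be a linear subspace dense in $\mathcal{H}$. Then the generalized effect algebra $\mathcal{G}_D(\mathcal{H})$ possesses an order determining set of generalized states.
   Context: A generalized effect algebra $(E;\oplus,0)$ is a set $E$ with an element $0\in E$ and a partial binary operation $\oplus$ such that for all $x,y,z\in E$: (GE1) $x\oplus y=y\oplus x$ if one side is defined; (GE2) $(x\oplus y)\oplus z=x\oplus(y\oplus z)$ if one side is defined; (GE3) $x\oplus y=x\oplus z$ implies $y=z$; (GE4) $x\oplus y=0$ implies $x=y=0$; (GE5) $x\oplus 0=x$. The partial order is: $x\le y$ iff there is $z$ with $x\oplus z$ defined and $x\oplus z=y$. $\mathcal{G}_D(\mathcal{H})$ is the set of all positive linear operators $A:D\to\mathcal{H}$ (i.e. $\langle \mathbf{x},A\mathbf{x}\rangle\ge 0$ for all $\mathbf{x}\in D$); with $\oplus$ the usual (everywhere defined) sum of operators on $D$ and $0$ the null operator it is a generalized effect algebra, in which $A\le B$ iff $B-A$ is positive. A generalized state on a generalized effect algebra $E$ is a map $s:E\to\mathbb{R}^+_0$ into the nonnegative reals with $s(a\oplus b)=s(a)+s(b)$ whenever $a\oplus b$ is defined. A set $S$ of generalized states on $E$ is order determining if ($s(a)\le s(b)$ for all $s\in S$) implies $a\le b$, for all $a,b\in E$. *)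

theory Defs
  imports "HOL-Analysis.Analysis"
begin

section \<open>Complex Hilbert spaces\<close>

text \<open>
  The inner product is antilinear in its first and linear in its second argument. Completeness
  and the topology come from \<^class>\<open>banach\<close>; positive definiteness of the inner product is
  contained in the axiom relating it to the norm.
\<close>

class chilbert_space = banach +
  fixes scaleC :: "complex \<Rightarrow> 'a \<Rightarrow> 'a" (infixr "*\<^sub>C" 75)
    and cinner :: "'a \<Rightarrow> 'a \<Rightarrow> complex"
  assumes scaleC_add_right: "c *\<^sub>C (x + y) = c *\<^sub>C x + c *\<^sub>C y"
    and scaleC_add_left: "(c + d) *\<^sub>C x = c *\<^sub>C x + d *\<^sub>C x"
    and scaleC_scaleC: "c *\<^sub>C (d *\<^sub>C x) = (c * d) *\<^sub>C x"
    and scaleC_of_real: "complex_of_real r *\<^sub>C x = r *\<^sub>R x"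
    and cinner_commute: "cinner x y = cnj (cinner y x)"
    and cinner_add_right: "cinner x (y + z) = cinner x y + cinner x z"
    and cinner_scaleC_right: "cinner x (c *\<^sub>C y) = c * cinner x y"
    and cinner_self: "cinner x x = complex_of_real ((norm x)\<^sup>2)"

global_interpretation complex_vector:
  vector_space "scaleC :: complex \<Rightarrow> 'a \<Rightarrow> 'a::chilbert_space"
proof
  show "1 *\<^sub>C x = x" for x :: 'a
    using scaleC_of_real[of 1 x] by simp
qed (simp_all add: scaleC_add_right scaleC_add_left scaleC_scaleC)

instantiation complex :: chilbert_space
begin

definition scaleC_complex :: "complex \<Rightarrow> complex \<Rightarrow> complex" where
  "scaleC_complex c x = c * x"

definition cinner_complex :: "complex \<Rightarrow> complex \<Rightarrow> complex" where
  "cinner_complex x y = cnj x * y"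

instance
proof
  show "cinner x x = complex_of_real ((norm x)\<^sup>2)" for x :: complex
    unfolding cinner_complex_def by (metis complex_norm_square mult.commute)
qed (simp_all add: scaleC_complex_def cinner_complex_def algebra_simps scaleR_conv_of_real)

end

section \<open>Generalized effect algebras\<close>

text \<open>A partial operation is a function into an option type; \<^const>\<open>None\<close> means undefined.\<close>

record 'a partial_algebra =
  elems :: "'a set"
  oplus :: "'a \<Rightarrow> 'a \<Rightarrow> 'a option"
  nul :: 'a

locale generalized_effect_algebra =
  fixes E :: "'a partial_algebra"
  assumes nul_closed: "nul E \<in> elems E"
    and oplus_closed:
      "\<lbrakk>x \<in> elems E; y \<in> elems E; oplus E x y = Some z\<rbrakk> \<Longrightarrow> z \<in> elems E"
    and GE1: "\<lbrakk>x \<in> elems E; y \<in> elems E\<rbrakk> \<Longrightarrow> oplus E x y = oplus E y x"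
    and GE2: "\<lbrakk>x \<in> elems E; y \<in> elems E; z \<in> elems E\<rbrakk> \<Longrightarrow>
      Option.bind (oplus E x y) (\<lambda>u. oplus E u z) = Option.bind (oplus E y z) (\<lambda>v. oplus E x v)"
    and GE3: "\<lbrakk>x \<in> elems E; y \<in> elems E; z \<in> elems E;
      oplus E x y = Some u; oplus E x z = Some u\<rbrakk> \<Longrightarrow> y = z"
    and GE4: "\<lbrakk>x \<in> elems E; y \<in> elems E; oplus E x y = Some (nul E)\<rbrakk> \<Longrightarrow>
      x = nul E \<and> y = nul E"
    and GE5: "x \<in> elems E \<Longrightarrow> oplus E x (nul E) = Some x"

definition gea_le :: "'a partial_algebra \<Rightarrow> 'a \<Rightarrow> 'a \<Rightarrow> bool" where
  "gea_le E x y \<longleftrightarrow> (\<exists>z\<in>elems E. oplus E x z = Some y)"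

text \<open>Only the values of a state on the elements of the algebra are constrained.\<close>

definition generalized_state :: "'a partial_algebra \<Rightarrow> ('a \<Rightarrow> real) \<Rightarrow> bool" where
  "generalized_state E s \<longleftrightarrow>
    (\<forall>a\<in>elems E. 0 \<le> s a) \<and>
    (\<forall>a\<in>elems E. \<forall>b\<in>elems E. \<forall>c. oplus E a b = Some c \<longrightarrow> s c = s a + s b)"

definition order_determining :: "'a partial_algebra \<Rightarrow> ('a \<Rightarrow> real) set \<Rightarrow> bool" where
  "order_determining E S \<longleftrightarrow>
    (\<forall>a\<in>elems E. \<forall>b\<in>elems E. (\<forall>s\<in>S. s a \<le> s b) \<longrightarrow> gea_le E a b)"

section \<open>Positive operators on a dense domain\<close>

text \<open>
  An operator with domain \<open>D\<close> is a function that is \<^const>\<open>undefined\<close> outside \<open>D\<close>, so that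
  equality of functions is equality of operators.
\<close>

definition linear_operators :: "'h::chilbert_space set \<Rightarrow> ('h \<Rightarrow> 'h) set" where
  "linear_operators D = {A \<in> extensional D.
    (\<forall>x\<in>D. \<forall>y\<in>D. A (x + y) = A x + A y) \<and>
    (\<forall>c. \<forall>x\<in>D. A (c *\<^sub>C x) = c *\<^sub>C A x)}"

definition positive_operators :: "'h::chilbert_space set \<Rightarrow> ('h \<Rightarrow> 'h) set" where
  "positive_operators D = {A \<in> linear_operators D. \<forall>x\<in>D. cinner x (A x) \<in> \<real>\<^sub>\<ge>\<^sub>0}"

definition GD :: "'h::chilbert_space set \<Rightarrow> ('h \<Rightarrow> 'h) partial_algebra" where
  "GD D = \<lparr>elems = positive_operators D,
           oplus = (\<lambda>A B. Some (\<lambda>x\<in>D. A x + B x)),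
           nul = (\<lambda>x\<in>D. 0)\<rparr>"

lemma cinner_zero_right [simp]: "cinner x (0 :: 'h::chilbert_space) = 0"
  using cinner_add_right[of x 0 0] by simp

lemma cinner_add_left: "cinner (x + y) z = cinner x z + cinner y (z :: 'h::chilbert_space)"
  by (metis cinner_commute cinner_add_right complex_cnj_add)

lemma cinner_scaleC_left: "cinner (c *\<^sub>C x) y = cnj c * cinner x (y :: 'h::chilbert_space)"
  by (metis cinner_commute cinner_scaleC_right complex_cnj_mult)

lemma eq_zero_if_orthogonal_to_dense:
  fixes D :: "'h::chilbert_space set"
  assumes dense: "closure D = UNIV" and orth: "\<And>x. x \<in> D \<Longrightarrow> cinner x z = 0"
  shows "z = 0"
proof (rule ccontr)
  assume "z \<noteq> 0"
  then obtain d where d: "d \<in> D" "dist d z < norm z"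
    using dense closure_approachable[of z D] by (metis UNIV_I zero_less_norm_iff)
  have dz: "cinner d z = 0" "cinner z d = 0"
    using orth[OF d(1)] cinner_commute[of z d] by auto
  define w where "w = z - d"
  have z: "z = d + w" by (simp add: w_def)
  have "cinner d w = - cinner d d"
    using dz(1) cinner_add_right[of d d w] z by (simp add: add_eq_0_iff)
  moreover have "cinner w d = - cinner d d"
    using dz(2) cinner_add_left[of d w d] z by (simp add: add_eq_0_iff)
  ultimately have "cinner z z = cinner w w - cinner d d"
    by (simp add: z cinner_add_left cinner_add_right)
  then have "complex_of_real ((norm z)\<^sup>2) = complex_of_real ((norm w)\<^sup>2 - (norm d)\<^sup>2)"
    by (simp only: cinner_self of_real_diff)
  then have "(norm z)\<^sup>2 = (norm w)\<^sup>2 - (norm d)\<^sup>2" by (simp only: of_real_eq_iff)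
  then have "(norm z)\<^sup>2 \<le> (norm w)\<^sup>2" by simp
  then have "norm z \<le> norm w" by (rule power2_le_imp_le) simp
  with d(2) show False by (simp add: w_def dist_norm norm_minus_commute)
qed

lemma operator_zero_if_form_zero:
  fixes D :: "'h::chilbert_space set"
  assumes sub: "complex_vector.subspace D" and dense: "closure D = UNIV"
    and A: "A \<in> linear_operators D" and form: "\<And>x. x \<in> D \<Longrightarrow> cinner x (A x) = 0"
  shows "A = (\<lambda>x\<in>D. 0)"
proof -
  have zero: "cinner x (A y) = 0" if x: "x \<in> D" and y: "y \<in> D" for x y
  proof -
    have pol: "cinner x (A v) + cinner v (A x) = 0" if v: "v \<in> D" for v
    proof -
      have "cinner (x + v) (A (x + v)) = 0"
        using form complex_vector.subspace_add[OF sub x v] by blast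
      moreover have "A (x + v) = A x + A v"
        using A x v by (simp add: linear_operators_def)
      ultimately show ?thesis
        using form[OF x] form[OF v] by (simp add: cinner_add_left cinner_add_right add.commute)
    qed
    have "A (\<i> *\<^sub>C y) = \<i> *\<^sub>C A y"
      using A y by (simp add: linear_operators_def)
    with pol[OF complex_vector.subspace_scale[OF sub y, of \<i>]]
    have "\<i> * (cinner x (A y) - cinner y (A x)) = 0"
      by (simp add: cinner_scaleC_left cinner_scaleC_right algebra_simps)
    then have "cinner x (A y) = cinner y (A x)" by simp
    with pol[OF y] show ?thesis by simp
  qed
  have "A y = 0" if "y \<in> D" for y
    using eq_zero_if_orthogonal_to_dense[OF dense, of "A y"] zero that by blast
  with A show ?thesis
    by (auto simp: linear_operators_def extensional_def fun_eq_iff)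
qed

lemma generalized_effect_algebra_GD:
  fixes D :: "'h::chilbert_space set"
  assumes sub: "complex_vector.subspace D" and dense: "closure D = UNIV"
  shows "generalized_effect_algebra (GD D)"
proof
  note add = complex_vector.subspace_add[OF sub] and scale = complex_vector.subspace_scale[OF sub]
  note defs = GD_def positive_operators_def linear_operators_def
  show "nul (GD D) \<in> elems (GD D)"
    using add scale by (simp add: defs)
  fix A B C U
  assume AB: "A \<in> elems (GD D)" "B \<in> elems (GD D)"
  show "C \<in> elems (GD D)" if "oplus (GD D) A B = Some C"
    using that AB add scale
    by (auto simp: defs cinner_add_right scaleC_add_right add_ac intro: nonneg_Reals_add_I)
  show "oplus (GD D) A B = oplus (GD D) B A"
    by (simp add: GD_def add.commute)
  show "A = nul (GD D) \<and> B = nul (GD D)" if null: "oplus (GD D) A B = Some (nul (GD D))"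
  proof -
    have form: "cinner x (A x) = 0 \<and> cinner x (B x) = 0" if x: "x \<in> D" for x
    proof -
      have "A x + B x = 0"
        using null x by (simp add: GD_def restrict_def fun_eq_iff) metis
      then have "cinner x (A x) + cinner x (B x) = 0"
        by (metis cinner_add_right cinner_zero_right)
      moreover have "cinner x (A x) \<in> \<real>\<^sub>\<ge>\<^sub>0" "cinner x (B x) \<in> \<real>\<^sub>\<ge>\<^sub>0"
        using AB x by (auto simp: GD_def positive_operators_def)
      ultimately show ?thesis
        by (auto simp: complex_nonneg_Reals_iff complex_eq_iff)
    qed
    have "A = (\<lambda>x\<in>D. 0)" "B = (\<lambda>x\<in>D. 0)"
      using AB form
      by (auto intro!: operator_zero_if_form_zero[OF sub dense]
          simp: GD_def positive_operators_def)
    then show ?thesis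
      by (simp add: GD_def)
  qed
  show "oplus (GD D) A (nul (GD D)) = Some A"
    using AB by (auto simp: defs extensional_def fun_eq_iff)
  assume C: "C \<in> elems (GD D)"
  show "Option.bind (oplus (GD D) A B) (\<lambda>u. oplus (GD D) u C) =
        Option.bind (oplus (GD D) B C) (\<lambda>v. oplus (GD D) A v)"
    by (simp add: GD_def restrict_def fun_eq_iff add.assoc)
  show "B = C" if AU: "oplus (GD D) A B = Some U" "oplus (GD D) A C = Some U"
  proof -
    have "B x = C x" if "x \<in> D" for x
    proof -
      have "(\<lambda>x\<in>D. A x + B x) x = (\<lambda>x\<in>D. A x + C x) x"
        using AU by (simp add: GD_def)
      with that show ?thesis by simp
    qed
    then show ?thesis
      using AB C by (intro extensionalityI[of B D]) (auto simp: defs)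
  qed
qed

end

theory Submission
  imports Defs
begin

text \<open>The order of \<open>GD D\<close> is already given by quadratic forms. Each vector
  \<open>x\<close> of \<open>D\<close> yields the state sending \<open>A\<close> to
  \<open>cinner x (A x)\<close> (\<open>generalized_state_vector\<close>). If every such state is at
  most as large at \<open>A\<close> as at \<open>B\<close>, the form of \<open>B - A\<close> is
  nonnegative, so \<open>B - A\<close> is a positive operator and witnesses that \<open>A\<close>
  lies below \<open>B\<close> (\<open>gea_le_GD_if_forms_le\<close>).\<close>

lemma cinner_diff_right: "cinner x (y - z) = cinner x y - cinner x (z :: 'h::chilbert_space)"
  using cinner_add_right[of x "y - z" z] by (simp add: eq_diff_eq)

lemma generalized_state_vector:
  assumes "x \<in> D"
  shows "generalized_state (GD D) (\<lambda>A. Re (cinner x (A x)))"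
  using assms
  by (auto simp: generalized_state_def GD_def positive_operators_def complex_nonneg_Reals_iff
      cinner_add_right)

lemma gea_le_GD_if_forms_le:
  fixes D :: "'h::chilbert_space set"
  assumes sub: "complex_vector.subspace D"
    and A: "A \<in> positive_operators D" and B: "B \<in> positive_operators D"
    and le: "\<And>x. x \<in> D \<Longrightarrow> Re (cinner x (A x)) \<le> Re (cinner x (B x))"
  shows "gea_le (GD D) A B"
proof -
  \<comment> \<open>Cancellation leaves the difference as the only candidate; restricting it to
    \<open>D\<close> makes it extensional.\<close>
  define C where "C = (\<lambda>x\<in>D. B x - A x)"
  have "C \<in> linear_operators D"
    using A B complex_vector.subspace_add[OF sub] complex_vector.subspace_scale[OF sub]
    by (auto simp: C_def positive_operators_def linear_operators_def
        complex_vector.scale_right_diff_distrib)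
  \<comment> \<open>Both forms are real because \<open>A\<close> and \<open>B\<close> are positive,
    so comparing real parts loses nothing.\<close>
  moreover have "cinner x (C x) \<in> \<real>\<^sub>\<ge>\<^sub>0" if "x \<in> D" for x
    using A B le[OF that] that
    by (auto simp: C_def positive_operators_def complex_nonneg_Reals_iff cinner_diff_right)
  ultimately have "C \<in> elems (GD D)"
    by (simp add: GD_def positive_operators_def)
  moreover have "(\<lambda>x\<in>D. A x + C x) = B"
    using B by (auto simp: C_def positive_operators_def linear_operators_def extensional_def)
  ultimately show ?thesis
    by (auto simp: gea_le_def GD_def)
qed

theorem corollary4p2:
  fixes D :: "'h::chilbert_space set"
  assumes "complex_vector.subspace D"
    and "closure D = UNIV"
  shows "\<exists>S. (\<forall>s\<in>S. generalized_state (GD D) s) \<and> order_determining (GD D) S"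
proof (intro exI conjI)
  \<comment> \<open>The vector states, unnormalized: \<open>x\<close> runs through all of
    \<open>D\<close>.\<close>
  let ?S = "(\<lambda>x A. Re (cinner x (A x))) ` D"
  show "\<forall>s\<in>?S. generalized_state (GD D) s"
    using generalized_state_vector by blast
  show "order_determining (GD D) ?S"
    using gea_le_GD_if_forms_le[OF assms(1)]
    by (auto simp: order_determining_def GD_def)
qed

end
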